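(* Let $C\in\mathcal{C}$ be a bivariate copula and let $G,H\in D(\mathbb{R})$ with $G\preceq_{st}H$. Then $\eta(C,G,H)\geq\eta(C)$.
   Context: $\mathcal{C}$ is the class of all bivariate copulas (joint distribution functions on $[0,1]^2$ with uniform marginals). $D(\mathbb{R})$ is the space of all probability distribution functions on $\mathbb{R}$, and $\mathcal{G}\subset D(\mathbb{R})$ is the class of those that are continuous and strictly increasing in the domain where they are positive and smaller than one. For $G_1,G_2\in D(\mathbb{R})$ and $C\in\mathcal{C}$, $\eta(C,G_1,G_2):=\mathbb{P}(X_1\leq X_2)$, where $(X_1,X_2)$ is a random vector with joint distribution function $F(x_1,x_2)=C(G_1(x_1),G_2(x_2))$. For $G\in\mathcal{G}$ the value $\eta(C,G,G)$ does not depend on the choice of $G\in\mathcal{G}$; it is denoted $\eta(C):=\eta(C,G,G)$ (with $G\in\mathcal{G}$), and it equals $\int_{A\cap[0,1]^2}dC$ with $A=\{(x_1,x_2)\in\mathbb{R}^2: x_1\leq x_2\}$. The usual stochastic order is: $G\preceq_{st}H$ iff $G(t)\geq H(t)$ for all $t\in\mathbb{R}$. *)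

theory Defs
  imports "HOL-Probability.Probability"
begin

definition biv_distribution :: "(real \<times> real) measure \<Rightarrow> bool" where
  "biv_distribution M \<longleftrightarrow> prob_space M \<and> sets M = sets borel"

definition joint_cdf :: "(real \<times> real) measure \<Rightarrow> real \<Rightarrow> real \<Rightarrow> real" where
  "joint_cdf M x1 x2 = measure M ({..x1} \<times> {..x2})"

(* A copula is a function on the unit square; its values outside are not constrained. *)
definition copula :: "(real \<Rightarrow> real \<Rightarrow> real) \<Rightarrow> bool" where
  "copula C \<longleftrightarrow>
     (\<exists>M. biv_distribution M
        \<and> distr M borel fst = uniform_measure lborel {0..1}
        \<and> distr M borel snd = uniform_measure lborel {0..1}
        \<and> (\<forall>u\<in>{0..1}. \<forall>v\<in>{0..1}. C u v = joint_cdf M u v))"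

definition prob_dfs :: "(real \<Rightarrow> real) set" where
  "prob_dfs = {G. \<exists>M. real_distribution M \<and> G = cdf M}"

(* Continuity is required on the whole line: were it only required where 0 < G < 1,
   a point mass would be admitted, and the value of eta C G G would depend on G. *)
definition cont_incr_dfs :: "(real \<Rightarrow> real) set" where
  "cont_incr_dfs =
     {G \<in> prob_dfs. continuous_on UNIV G \<and> strict_mono_on {x. 0 < G x \<and> G x < 1} G}"

(* The law of a random vector with joint distribution function C (G1 x1) (G2 x2).
   For a copula C and G1, G2 in prob_dfs it exists by Sklar's theorem, and it is unique
   because a law on the plane is determined by its joint distribution function. *)
definition joint_law ::
  "(real \<Rightarrow> real \<Rightarrow> real) \<Rightarrow> (real \<Rightarrow> real) \<Rightarrow> (real \<Rightarrow> real) \<Rightarrow> (real \<times> real) measure" where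
  "joint_law C G1 G2 =
     (THE M. biv_distribution M \<and> (\<forall>x1 x2. joint_cdf M x1 x2 = C (G1 x1) (G2 x2)))"

definition eta :: "(real \<Rightarrow> real \<Rightarrow> real) \<Rightarrow> (real \<Rightarrow> real) \<Rightarrow> (real \<Rightarrow> real) \<Rightarrow> real" where
  "eta C G1 G2 = measure (joint_law C G1 G2) {(x1, x2). x1 \<le> x2}"

(* The common value of eta C G G over all G in cont_incr_dfs. *)
definition eta_copula :: "(real \<Rightarrow> real \<Rightarrow> real) \<Rightarrow> real" where
  "eta_copula C = (THE e. \<forall>G\<in>cont_incr_dfs. eta C G G = e)"

definition st_le :: "(real \<Rightarrow> real) \<Rightarrow> (real \<Rightarrow> real) \<Rightarrow> bool"  (infix "\<preceq>\<^sub>s\<^sub>t" 50) where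
  "G \<preceq>\<^sub>s\<^sub>t H \<longleftrightarrow> (\<forall>t. G t \<ge> H t)"

end

theory Submission
  imports Defs
begin

text \<open>
  The proof is a coupling by quantile transforms. Let \<open>(U, V)\<close> have law \<open>M\<close>, the probability
  measure with uniform marginals whose distribution function on the unit square is the copula \<open>C\<close>. For a distribution
  function \<open>G\<close> with quantile function \<open>q\<^sub>G u = Inf {x. u \<le> G x}\<close>, the equivalence
  \<open>q\<^sub>G u \<le> x \<longleftrightarrow> u \<le> G x\<close> (lemma \<open>quantile_le_iff\<close>) shows that \<open>(q\<^sub>G U, q\<^sub>H V)\<close> has joint distribution
  function \<open>C (G x) (H y)\<close>. As a law on the plane is determined by its joint distribution function,
  this vector realises \<open>joint_law C G H\<close> (lemma \<open>joint_law_eq_distr\<close>), and so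
  \<open>eta C G H = P(q\<^sub>G U \<le> q\<^sub>H V)\<close> for every pair \<open>(G, H)\<close>, all on one probability space.

  On this space it remains to compare events. If \<open>G\<close> precedes \<open>H\<close> in the stochastic order, then
  \<open>q\<^sub>G \<le> q\<^sub>H\<close>, so \<open>U \<le> V\<close> forces \<open>q\<^sub>G U \<le> q\<^sub>G V \<le> q\<^sub>H V\<close>, whence \<open>eta C G H \<ge> P(U \<le> V)\<close>. If \<open>G\<close> is
  continuous, then \<open>q\<^sub>G\<close> is a right inverse of \<open>G\<close>, hence strictly increasing, so \<open>q\<^sub>G U \<le> q\<^sub>G V\<close> is
  almost surely the same event as \<open>U \<le> V\<close>; therefore \<open>eta_copula C = P(U \<le> V)\<close>.
\<close>

text \<open>
  Almost surely both coordinates of a copula law lie in the open interval \<open>(0, 1)\<close>. Outside it the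
  infimum may be taken over an empty or unbounded set; the value \<open>0\<close> there makes the function Borel
  measurable on the whole line.
\<close>
definition quantile :: "(real \<Rightarrow> real) \<Rightarrow> real \<Rightarrow> real" where
  "quantile G u = (if u \<in> {0<..<1} then Inf {x. u \<le> G x} else 0)"

text \<open>
  A distribution function is right-continuous, so the infimum defining the quantile is attained;
  this gives the forward direction, and the other is the lower bound property of the infimum.
\<close>
lemma quantile_le_iff:
  assumes "G \<in> prob_dfs" and "0 < u" and "u < 1"
  shows "quantile G u \<le> x \<longleftrightarrow> u \<le> G x"
proof -
  obtain M where "real_distribution M" and G: "G = cdf M"
    using assms(1) by (auto simp: prob_dfs_def)
  then interpret cdf_distribution M by (simp add: cdf_distribution_def)
  show ?thesis
    using pseudoinverse[of u x] assms(2,3) by (simp add: quantile_def G)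
qed

lemma borel_measurable_quantile [measurable]:
  assumes "G \<in> prob_dfs"
  shows "quantile G \<in> borel_measurable borel"
proof -
  obtain M where "real_distribution M" and G: "G = cdf M"
    using assms by (auto simp: prob_dfs_def)
  then interpret cdf_distribution M by (simp add: cdf_distribution_def)
  show ?thesis
    unfolding quantile_def G
    by (subst measurable_If_restrict_space_iff) (use measurable_CI in \<open>simp_all add: greaterThanLessThan_eq Int_def conj_commute\<close>)
qed

lemma prob_dfs_bounds:
  assumes "G \<in> prob_dfs"
  shows "G x \<in> {0..1}"
proof -
  obtain M where "real_distribution M" and G: "G = cdf M"
    using assms by (auto simp: prob_dfs_def)
  then interpret real_distribution M by simp
  show ?thesis
    by (simp add: G cdf_nonneg cdf_bounded_prob)
qed

lemma quantile_le_quantile: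
  assumes G: "G \<in> prob_dfs" and H: "H \<in> prob_dfs" and GH: "G \<preceq>\<^sub>s\<^sub>t H"
    and uv: "0 < u" "u \<le> v" "v < 1"
  shows "quantile G u \<le> quantile H v"
proof -
  have "v \<le> H (quantile H v)"
    using quantile_le_iff[OF H, of v "quantile H v"] uv by simp
  also have "\<dots> \<le> G (quantile H v)"
    using GH by (simp add: st_le_def)
  finally show ?thesis
    using quantile_le_iff[OF G, of u "quantile H v"] uv by simp
qed

text \<open>
  At a continuity point a distribution function cannot jump over the level \<open>u\<close>: were
  \<open>G\<close> larger than \<open>u\<close> at the quantile, it would still be so slightly to the left of it.
\<close>
lemma continuous_df_quantile:
  assumes G: "G \<in> prob_dfs" and cont: "continuous_on UNIV G" and u: "0 < u" "u < 1"
  shows "G (quantile G u) = u"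
proof (rule antisym)
  let ?q = "quantile G u"
  show "u \<le> G ?q"
    using quantile_le_iff[OF G u, of ?q] by simp
  have "(G \<longlongrightarrow> G ?q) (at_left ?q)"
    using cont by (auto simp: continuous_on_eq_continuous_at isCont_def intro: tendsto_within_subset)
  moreover have "eventually (\<lambda>x. G x \<le> u) (at_left ?q)"
    using quantile_le_iff[OF G u]
    by (auto simp: eventually_at_filter intro!: always_eventually) (meson not_le linear less_imp_le)
  ultimately show "G ?q \<le> u"
    by (rule tendsto_upperbound) simp
qed

lemma continuous_quantile_le_quantile_iff:
  assumes G: "G \<in> prob_dfs" and cont: "continuous_on UNIV G"
    and u: "0 < u" "u < 1" and v: "0 < v" "v < 1"
  shows "quantile G u \<le> quantile G v \<longleftrightarrow> u \<le> v"
  using quantile_le_iff[OF G u, of "quantile G v"] continuous_df_quantile[OF G cont v] by simp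

text \<open>
  The quadrants \<open>{..x} \<times> {..y}\<close> are closed under intersection and generate the Borel sets of the
  plane, so a finite measure is determined by its values on them.
\<close>
lemma biv_distribution_eqI:
  assumes M: "biv_distribution M" and N: "biv_distribution N"
    and eq: "\<And>x y. joint_cdf M x y = joint_cdf N x y"
  shows "M = N"
proof -
  interpret M: prob_space M using M by (simp add: biv_distribution_def)
  interpret N: prob_space N using N by (simp add: biv_distribution_def)
  let ?E = "range (\<lambda>(x::real, y::real). {..x} \<times> {..y})"
  have "range (\<lambda>a::real \<times> real. {..a}) = ?E"
    by (intro image_cong) (auto simp: less_eq_prod_def)
  then have gen: "sets borel = sigma_sets UNIV ?E"
    by (simp add: borel_eq_atMost)
  show ?thesis
  proof (rule measure_eqI_generator_eq[where A = "\<lambda>n. {..real n} \<times> {..real n}" and \<Omega> = UNIV and E = ?E])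
    show "Int_stable ?E"
      by (force intro!: Int_stableI_image simp: Times_Int_Times split: prod.splits)
    show "emeasure M X = emeasure N X" if "X \<in> ?E" for X
      using that eq by (auto simp: joint_cdf_def M.emeasure_eq_measure N.emeasure_eq_measure)
    show "sets M = sigma_sets UNIV ?E" "sets N = sigma_sets UNIV ?E"
      using M N gen by (simp_all add: biv_distribution_def)
    show "range (\<lambda>n. {..real n} \<times> {..real n}) \<subseteq> ?E"
      by auto
    have "\<exists>n. x \<le> real n \<and> y \<le> real n" for x y :: real
      using real_arch_simple[of "max x y"] by auto
    then show "(\<Union>n. {..real n} \<times> {..real n}) = UNIV"
      by auto
  qed auto
qed

text \<open>
  The law whose existence \<open>copula\<close> asserts, named so that one and the same \<open>M\<close> can serve all
  pairs of marginals.
\<close>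
definition copula_law :: "(real \<Rightarrow> real \<Rightarrow> real) \<Rightarrow> (real \<times> real) measure \<Rightarrow> bool" where
  "copula_law C M \<longleftrightarrow>
     biv_distribution M
     \<and> distr M borel fst = uniform_measure lborel {0..1}
     \<and> distr M borel snd = uniform_measure lborel {0..1}
     \<and> (\<forall>u\<in>{0..1}. \<forall>v\<in>{0..1}. C u v = joint_cdf M u v)"

lemma AE_uniform_open_unit_interval:
  "AE x in uniform_measure lborel {0..1::real}. 0 < x \<and> x < 1"
proof (rule AE_uniform_measureI)
  show "AE x in lborel. x \<in> {0..1::real} \<longrightarrow> 0 < x \<and> x < 1"
    using AE_lborel_singleton[of "0::real"] AE_lborel_singleton[of "1::real"]
    by eventually_elim auto
qed simp

lemma copula_law_prob_space:
  assumes "copula_law C M"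
  shows "prob_space M"
  using assms by (simp add: copula_law_def biv_distribution_def)

lemma copula_law_sets:
  assumes "copula_law C M"
  shows "sets M = sets (borel \<Otimes>\<^sub>M borel)"
  unfolding borel_prod using assms by (simp add: copula_law_def biv_distribution_def)

lemma copula_law_AE:
  assumes "copula_law C M"
  shows "AE p in M. 0 < fst p \<and> fst p < 1 \<and> 0 < snd p \<and> snd p < 1"
proof -
  note copula_law_sets[OF assms, measurable_cong]
  have [measurable]: "fst \<in> borel_measurable M" "snd \<in> borel_measurable M"
    by measurable
  have marginals: "uniform_measure lborel {0..1} = distr M borel fst"
      "uniform_measure lborel {0..1} = distr M borel snd"
    using assms by (simp_all add: copula_law_def)
  have "AE p in M. 0 < fst p \<and> fst p < 1"
    by (rule AE_distrD[OF _ AE_uniform_open_unit_interval[unfolded marginals(1)]]) simp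
  moreover have "AE p in M. 0 < snd p \<and> snd p < 1"
    by (rule AE_distrD[OF _ AE_uniform_open_unit_interval[unfolded marginals(2)]]) simp
  ultimately show ?thesis
    by eventually_elim simp
qed

text \<open>
  The existence half of Sklar's theorem, with an explicit coupling. Almost surely
  \<open>0 < U, V < 1\<close>, so by \<open>quantile_le_iff\<close> the transformed vector lies in \<open>{..x} \<times> {..y}\<close> exactly
  when \<open>(U, V)\<close> lies in \<open>{..G x} \<times> {..H y}\<close>, an event of probability \<open>C (G x) (H y)\<close>.
\<close>
lemma joint_law_eq_distr:
  assumes CM: "copula_law C M" and G[measurable]: "G \<in> prob_dfs" and H[measurable]: "H \<in> prob_dfs"
  shows "joint_law C G H = distr M borel (\<lambda>p. (quantile G (fst p), quantile H (snd p)))"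
proof -
  let ?f = "\<lambda>p. (quantile G (fst p), quantile H (snd p))"
  note sets_M [measurable_cong] = copula_law_sets[OF CM]
  interpret prob_space M by (rule copula_law_prob_space[OF CM])
  have f [measurable]: "?f \<in> borel_measurable M"
    by measurable
  have space_M: "space M = UNIV"
    using sets_eq_imp_space_eq[OF sets_M] by (simp add: space_pair_measure)
  have law: "biv_distribution (distr M borel ?f)"
    by (simp add: biv_distribution_def prob_space_distr)
  have cdf: "joint_cdf (distr M borel ?f) x y = C (G x) (H y)" for x y
  proof -
    have "joint_cdf (distr M borel ?f) x y = measure M (?f -` ({..x} \<times> {..y}) \<inter> space M)"
      unfolding joint_cdf_def by (intro measure_distr) (auto simp: borel_Times)
    also have "\<dots> = measure M ({..G x} \<times> {..H y})"
    proof (rule finite_measure_eq_AE)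
      show "AE p in M. p \<in> ?f -` ({..x} \<times> {..y}) \<inter> space M \<longleftrightarrow> p \<in> {..G x} \<times> {..H y}"
        using copula_law_AE[OF CM]
        by eventually_elim
           (auto simp: space_M quantile_le_iff[OF G] quantile_le_iff[OF H] mem_Times_iff)
    qed (auto simp: sets_M borel_prod intro!: measurable_sets[OF f] borel_Times)
    also have "\<dots> = C (G x) (H y)"
      using CM prob_dfs_bounds[OF G] prob_dfs_bounds[OF H]
      by (simp add: copula_law_def joint_cdf_def)
    finally show ?thesis .
  qed
  show ?thesis
    unfolding joint_law_def
    by (rule the_equality) (auto simp: law cdf intro: biv_distribution_eqI)
qed

lemma eta_eq_measure_quantile:
  assumes CM: "copula_law C M" and G[measurable]: "G \<in> prob_dfs" and H[measurable]: "H \<in> prob_dfs"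
  shows "eta C G H = measure M {p \<in> space M. quantile G (fst p) \<le> quantile H (snd p)}"
proof -
  note copula_law_sets[OF CM, measurable_cong]
  have "closed {(x::real, y). x \<le> y}"
    unfolding case_prod_beta by (intro closed_Collect_le continuous_intros)
  then show ?thesis
    unfolding eta_def joint_law_eq_distr[OF CM G H]
    by (subst measure_distr) (auto intro!: arg_cong[where f = "measure M"])
qed

lemma eta_continuous:
  assumes CM: "copula_law C M" and G[measurable]: "G \<in> prob_dfs" and cont: "continuous_on UNIV G"
  shows "eta C G G = measure M {p \<in> space M. fst p \<le> snd p}"
proof -
  note copula_law_sets[OF CM, measurable_cong]
  interpret prob_space M by (rule copula_law_prob_space[OF CM])
  show ?thesis
    unfolding eta_eq_measure_quantile[OF CM G G]
  proof (rule finite_measure_eq_AE)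
    show "AE p in M. p \<in> {p \<in> space M. quantile G (fst p) \<le> quantile G (snd p)}
                 \<longleftrightarrow> p \<in> {p \<in> space M. fst p \<le> snd p}"
      using copula_law_AE[OF CM]
      by eventually_elim (simp add: continuous_quantile_le_quantile_iff[OF G cont])
  qed measurable
qed

text \<open>
  Were there no continuous strictly increasing distribution function, the condition defining
  \<open>eta_copula\<close> would hold of every number. The uniform distribution is a witness.
\<close>
lemma cont_incr_dfs_nonempty: "cont_incr_dfs \<noteq> {}"
proof -
  let ?U = "uniform_measure lborel {0..1::real}"
  have "prob_space ?U"
    by (rule prob_space_uniform_measure) auto
  then have U: "real_distribution ?U"
    by (simp add: real_distribution_def real_distribution_axioms_def)
  have "{0..1} \<inter> {..x} = {0..min 1 x}" for x :: real
    by auto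
  then have cdf: "cdf ?U = (\<lambda>x. max 0 (min 1 x))"
    by (auto simp: cdf_def fun_eq_iff max_def)
  have "continuous_on UNIV (cdf ?U)"
    unfolding cdf by (intro continuous_intros)
  moreover have "strict_mono_on {x. 0 < cdf ?U x \<and> cdf ?U x < 1} (cdf ?U)"
    unfolding cdf by (auto simp: strict_mono_on_def)
  ultimately have "cdf ?U \<in> cont_incr_dfs"
    using U by (auto simp: cont_incr_dfs_def prob_dfs_def)
  then show ?thesis by blast
qed

lemma eta_copula_eq_measure:
  assumes "copula_law C M"
  shows "eta_copula C = measure M {p \<in> space M. fst p \<le> snd p}"
  unfolding eta_copula_def
  using cont_incr_dfs_nonempty
  by (intro the_equality) (auto simp: cont_incr_dfs_def eta_continuous[OF assms])

theorem theorem6: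
  fixes C :: "real \<Rightarrow> real \<Rightarrow> real" and G H :: "real \<Rightarrow> real"
  assumes "copula C" and "G \<in> prob_dfs" and "H \<in> prob_dfs" and "G \<preceq>\<^sub>s\<^sub>t H"
  shows "eta C G H \<ge> eta_copula C"
proof -
  note G [measurable] = assms(2) and H [measurable] = assms(3)
  obtain M where CM: "copula_law C M"
    using assms(1) by (auto simp: copula_def copula_law_def)
  note copula_law_sets[OF CM, measurable_cong]
  interpret prob_space M by (rule copula_law_prob_space[OF CM])
  show ?thesis
    unfolding eta_copula_eq_measure[OF CM] eta_eq_measure_quantile[OF CM G H]
  proof (rule finite_measure_mono_AE)
    show "AE p in M. p \<in> {p \<in> space M. fst p \<le> snd p}
                 \<longrightarrow> p \<in> {p \<in> space M. quantile G (fst p) \<le> quantile H (snd p)}"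
      using copula_law_AE[OF CM]
      by eventually_elim (simp add: quantile_le_quantile[OF G H assms(4)])
  qed measurable
qed

end
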